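(* There is a family of polynomial systems $x'=p(x)$ on $\mathbb{R}^2$ which does not have a computable sharp upper bound on the number of its periodic orbits; namely, the family $\{p_k\}_{k\in\mathbb{N}}$, $\mathbb{N}=\{1,2,3,\dots\}$, given by $p_k(x,y)=(p_{k,1}(x,y),p_{k,2}(x,y))$ with $$p_{k,1}(x,y)=-y+x\prod_{j=1}^{k}\Bigl(x^2+y^2-\sum_{i=1}^{j}iG(i)\Bigr),\qquad p_{k,2}(x,y)=x+y\prod_{j=1}^{k}\Bigl(x^2+y^2-\sum_{i=1}^{j}iG(i)\Bigr),$$ where $G:\mathbb{N}\to[0,1/2]$ is the function defined in the context, has no computable sharp upper bound.
   Context: Fix a standard computable enumeration $TM_1,TM_2,\dots$ of all Turing machines. Let $g(k,i)=1$ if $TM_k$ halts in at most $i$ steps on input $k$, and $g(k,i)=0$ otherwise, and let $G(k)=\sum_{i=1}^{\infty}g(k,i)/2^{i+1}$. A periodic orbit of $x'=p(x)$ is a closed trajectory (not an equilibrium) $\gamma$ for which there is $T>0$ with $\phi_T(x)=x$ for all $x\in\gamma$, $\phi_t$ being the flow. Sharp upper bound: let $\{p_i\}_{i\in I}$ be a family of functions $p_i:\mathbb{R}^2\to\mathbb{R}^2$ with polynomial components. A sharp upper bound for the number of periodic orbits for this family is a function $F$ from $\mathbb{N}$ to the nonnegative integers such that, for every $n\in\mathbb{N}$: (1) if $p$ is a member of the family with components of degree at most $n$, then the number of periodic orbits of $x'=p(x)$ is $\le F(n)$; and (2) there is a member $p$ of the family with components of degree at most $n$ such that $x'=p(x)$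 has exactly $F(n)$ periodic orbits. Computable means computable by a Turing machine. *)

theory Defs
  imports "HOL-Analysis.Analysis" "HOL-Library.Nat_Bijection" "HOL-Library.Finite_Map"
begin

section \<open>Turing machines\<close>

datatype move = MoveLeft | MoveRight | Stay

text \<open>
  A deterministic machine with one two-way infinite tape is a finite table sending a pair
  (state, scanned symbol) to a triple (new state, written symbol, move). States and tape symbols are
  natural numbers: state 0 is the start state, symbol 0 is the blank and symbol 1 is the stroke used
  for unary numerals. As the table is finite, only finitely many states and symbols matter.
  The machine halts when its table has no entry for the current state and symbol.
\<close>

type_synonym turing_machine = "(nat \<times> nat, nat \<times> nat \<times> move) fmap"

text \<open>A configuration consists of the state, the head position and the tape contents.\<close>

type_synonym config = "nat \<times> int \<times> (int \<Rightarrow> nat)"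

fun displacement :: "move \<Rightarrow> int" where
  "displacement MoveLeft = - 1"
| "displacement MoveRight = 1"
| "displacement Stay = 0"

fun halted :: "turing_machine \<Rightarrow> config \<Rightarrow> bool" where
  "halted M (q, h, t) \<longleftrightarrow> fmlookup M (q, t h) = None"

text \<open>Halted configurations are fixed points of \<open>step\<close>.\<close>

fun step :: "turing_machine \<Rightarrow> config \<Rightarrow> config" where
  "step M (q, h, t) =
    (case fmlookup M (q, t h) of
       None \<Rightarrow> (q, h, t)
     | Some (q', s, d) \<Rightarrow> (q', h + displacement d, t(h := s)))"

definition unary_tape :: "nat \<Rightarrow> int \<Rightarrow> nat" where
  "unary_tape n = (\<lambda>i. if 0 \<le> i \<and> i < int n then 1 else 0)"

definition init_config :: "nat \<Rightarrow> config" where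
  "init_config n = (0, 0, unary_tape n)"

definition halts_within :: "turing_machine \<Rightarrow> nat \<Rightarrow> nat \<Rightarrow> bool" where
  "halts_within M n i \<longleftrightarrow> halted M ((step M ^^ i) (init_config n))"

text \<open>
  Functions are considered on the positive integers; the value at 0 is irrelevant. On input \<open>n\<close> the
  machine has to halt in standard position: the head is back at its initial cell and the tape
  contains exactly the unary numeral of \<open>f n\<close>, starting at that cell.
\<close>

definition computes :: "turing_machine \<Rightarrow> (nat \<Rightarrow> nat) \<Rightarrow> bool" where
  "computes M f \<longleftrightarrow>
    (\<forall>n\<ge>1. \<exists>i q. (step M ^^ i) (init_config n) = (q, 0, unary_tape (f n))
                 \<and> halted M (q, 0, unary_tape (f n)))"

definition computable :: "(nat \<Rightarrow> nat) \<Rightarrow> bool" where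
  "computable f \<longleftrightarrow> (\<exists>M. computes M f)"


section \<open>Computable enumerations of all Turing machines\<close>

definition move_of_code :: "nat \<Rightarrow> move" where
  "move_of_code n = (if n = 0 then MoveLeft else if n = 1 then MoveRight else Stay)"

definition entry_of_code :: "nat \<Rightarrow> (nat \<times> nat) \<times> (nat \<times> nat \<times> move)" where
  "entry_of_code n =
    (let (a, b) = prod_decode n; (q', c) = prod_decode b; (s', d) = prod_decode c
     in (prod_decode a, (q', s', move_of_code d)))"

text \<open>
  A code of a machine is a number that codes a list of the entries of its table (when a list has
  several entries for the same pair, the first one counts).
\<close>

definition machine_of_code :: "nat \<Rightarrow> turing_machine" where
  "machine_of_code n = fmap_of_list (map entry_of_code (list_decode n))"

text \<open>
  The enumeration is indexed by the positive integers, may have repetitions, and a code of the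
  \<open>k\<close>-th machine can be computed from \<open>k\<close>.
\<close>

definition computable_enumeration :: "(nat \<Rightarrow> turing_machine) \<Rightarrow> bool" where
  "computable_enumeration TM \<longleftrightarrow>
    TM ` {1..} = UNIV \<and>
    (\<exists>c. computable c \<and> (\<forall>k\<ge>1. TM k = machine_of_code (c k)))"


section \<open>Periodic orbits of planar systems\<close>

text \<open>
  \<open>flows_to p t x y\<close> says that the flow of \<open>x' = p(x)\<close> is defined at time \<open>t\<close> (of either sign) for
  the initial value \<open>x\<close>, and that its value there is \<open>y\<close>. It is a relation because solutions may
  blow up in finite time; for polynomial \<open>p\<close> it is single-valued by uniqueness of solutions.
\<close>

definition flows_to ::
  "(real \<times> real \<Rightarrow> real \<times> real) \<Rightarrow> real \<Rightarrow> real \<times> real \<Rightarrow> real \<times> real \<Rightarrow> bool" where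
  "flows_to p t x y \<longleftrightarrow>
    (\<exists>u. u 0 = x \<and> u t = y \<and>
      (\<forall>s\<in>closed_segment 0 t.
         (u has_vector_derivative p (u s)) (at s within closed_segment 0 t)))"

definition trajectory :: "(real \<times> real \<Rightarrow> real \<times> real) \<Rightarrow> real \<times> real \<Rightarrow> (real \<times> real) set" where
  "trajectory p x = {y. \<exists>t. flows_to p t x y}"

definition periodic_orbit :: "(real \<times> real \<Rightarrow> real \<times> real) \<Rightarrow> (real \<times> real) set \<Rightarrow> bool" where
  "periodic_orbit p \<gamma> \<longleftrightarrow>
    (\<exists>x. p x \<noteq> 0 \<and> \<gamma> = trajectory p x) \<and>
    (\<exists>T>0. \<forall>x\<in>\<gamma>. flows_to p T x x)"

definition periodic_orbits :: "(real \<times> real \<Rightarrow> real \<times> real) \<Rightarrow> (real \<times> real) set set" where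
  "periodic_orbits p = {\<gamma>. periodic_orbit p \<gamma>}"


section \<open>Polynomial families and sharp upper bounds\<close>

text \<open>
  Polynomials in two real variables are identified with the functions they induce; the degree is the
  total degree.
\<close>

definition polynomial_degree_le :: "nat \<Rightarrow> (real \<times> real \<Rightarrow> real) \<Rightarrow> bool" where
  "polynomial_degree_le n f \<longleftrightarrow>
    (\<exists>a. \<forall>x y. f (x, y) = (\<Sum>(i, j)\<in>{(i, j). i + j \<le> n}. a i j * x ^ i * y ^ j))"

definition components_degree_le :: "nat \<Rightarrow> (real \<times> real \<Rightarrow> real \<times> real) \<Rightarrow> bool" where
  "components_degree_le n p \<longleftrightarrow>
    polynomial_degree_le n (\<lambda>z. fst (p z)) \<and> polynomial_degree_le n (\<lambda>z. snd (p z))"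

definition polynomial_family :: "'i set \<Rightarrow> ('i \<Rightarrow> real \<times> real \<Rightarrow> real \<times> real) \<Rightarrow> bool" where
  "polynomial_family I p \<longleftrightarrow> (\<forall>i\<in>I. \<exists>n. components_degree_le n (p i))"

text \<open>
  The existence of a member attaining \<open>F n\<close> is demanded only for those \<open>n\<close> for which the family has a
  member of degree at most \<open>n\<close> at all. Without this guard a family with no member of degree at most 1
  could not have any sharp upper bound, computable or not. Finiteness is stated explicitly because
  the cardinality of an infinite set is 0 by convention.
\<close>

definition sharp_upper_bound ::
  "'i set \<Rightarrow> ('i \<Rightarrow> real \<times> real \<Rightarrow> real \<times> real) \<Rightarrow> (nat \<Rightarrow> nat) \<Rightarrow> bool" where
  "sharp_upper_bound I p F \<longleftrightarrow>
    (\<forall>n\<ge>1.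
      (\<forall>i\<in>I. components_degree_le n (p i) \<longrightarrow>
         finite (periodic_orbits (p i)) \<and> card (periodic_orbits (p i)) \<le> F n) \<and>
      ((\<exists>i\<in>I. components_degree_le n (p i)) \<longrightarrow>
         (\<exists>i\<in>I. components_degree_le n (p i) \<and>
            finite (periodic_orbits (p i)) \<and> card (periodic_orbits (p i)) = F n)))"

text \<open>A sharp upper bound in the unguarded sense is one in the guarded sense.\<close>

lemma sharp_upper_bound_if_unguarded:
  assumes "\<And>n i. n \<ge> 1 \<Longrightarrow> i \<in> I \<Longrightarrow> components_degree_le n (p i) \<Longrightarrow>
      finite (periodic_orbits (p i)) \<and> card (periodic_orbits (p i)) \<le> F n"
    and "\<And>n. n \<ge> 1 \<Longrightarrow> \<exists>i\<in>I. components_degree_le n (p i) \<and>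
      finite (periodic_orbits (p i)) \<and> card (periodic_orbits (p i)) = F n"
  shows "sharp_upper_bound I p F"
  using assms unfolding sharp_upper_bound_def by blast


section \<open>The family built from the halting problem\<close>

definition g :: "(nat \<Rightarrow> turing_machine) \<Rightarrow> nat \<Rightarrow> nat \<Rightarrow> real" where
  "g TM k i = (if halts_within (TM k) k i then 1 else 0)"

text \<open>The series over \<open>i = 1, 2, ...\<close> is written with \<open>Suc i\<close> in place of \<open>i\<close>.\<close>

definition G :: "(nat \<Rightarrow> turing_machine) \<Rightarrow> nat \<Rightarrow> real" where
  "G TM k = (\<Sum>i. g TM k (Suc i) / 2 ^ (Suc i + 1))"

definition halting_family :: "(nat \<Rightarrow> turing_machine) \<Rightarrow> nat \<Rightarrow> real \<times> real \<Rightarrow> real \<times> real" where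
  "halting_family TM k = (\<lambda>(x, y).
    (- y + x * (\<Prod>j=1..k. x^2 + y^2 - (\<Sum>i=1..j. real i * G TM i)),
     x + y * (\<Prod>j=1..k. x^2 + y^2 - (\<Sum>i=1..j. real i * G TM i))))"

end

theory Submission
  imports Defs "HOL-Computational_Algebra.Polynomial"
begin

text \<open>
  In polar coordinates the system $x' = p_k(x)$ is a rotation with constant angular speed together
  with a scalar equation for the squared radius $w$, namely $w' = 2 w P(w)$ where $P$ vanishes
  exactly at the numbers $S_j = \sum_{i \le j} i\,G(i)$ for $j \le k$. A solution of a scalar
  autonomous equation that returns to its initial value is at rest, so the periodic orbits are
  exactly the circles $w = c$ with $c > 0$ among the $S_j$ (\<open>periodic_orbits_radial_field\<close>). The
  sequence $S_j$ is nondecreasing, starts from $0$, and jumps at $j$ exactly when $G(j) > 0$, that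
  is, when the $j$-th machine halts on input $j$. Hence $p_{k}$ has more periodic orbits than
  $p_{k-1}$ iff the $k$-th machine halts on $k$ (\<open>card_radius_squares_eq_iff\<close>).

  The components of $p_k$ have degree exactly $2k + 1$, so the members of degree at most $2k + 2$
  are $p_1, \dots, p_k$, and a sharp upper bound $F$ takes the value at $2k + 2$ that counts the
  periodic orbits of $p_k$ (\<open>sharp_upper_bound_value\<close>). Even arguments are preferred to $2k + 1$ because
  they can be produced from $k$ on the tape without any copying, see below.

  If $F$ were computable, some machine $D$ would halt on $k$ exactly when $F(2k + 2) = F(2k)$
  (\<open>machine_detecting_equal_values\<close>), that is, for $k \ge 2$, exactly when the $k$-th machine does not
  halt on $k$. As $D$ itself occurs in the enumeration, choosing $k$ as an index of $D$ gives a
  contradiction. The index $1$ has to be avoided, as $F(2)$ is unconstrained; for this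
  reason $D$ is constructed so that it differs from a prescribed machine.
\<close>

section \<open>Machines over countable sets of states and symbols\<close>

text \<open>
  Machines are designed with structured states and symbols and only afterwards coded by natural
  numbers. A table is a partial function here; finiteness of its domain is only asked for when a
  machine is extracted from it.
\<close>

type_synonym ('q, 's) table = "'q \<times> 's \<Rightarrow> ('q \<times> 's \<times> move) option"

fun stopped :: "('q, 's) table \<Rightarrow> 'q \<times> int \<times> (int \<Rightarrow> 's) \<Rightarrow> bool" where
  "stopped \<delta> (q, h, z) \<longleftrightarrow> \<delta> (q, z h) = None"

fun next_config :: "('q, 's) table \<Rightarrow> 'q \<times> int \<times> (int \<Rightarrow> 's) \<Rightarrow> 'q \<times> int \<times> (int \<Rightarrow> 's)" where
  "next_config \<delta> (q, h, z) =
    (case \<delta> (q, z h) of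
       None \<Rightarrow> (q, h, z)
     | Some (q', s, d) \<Rightarrow> (q', h + displacement d, z(h := s)))"

definition halts :: "('q, 's) table \<Rightarrow> 'q \<times> int \<times> (int \<Rightarrow> 's) \<Rightarrow> bool" where
  "halts \<delta> c \<longleftrightarrow> (\<exists>n. stopped \<delta> ((next_config \<delta> ^^ n) c))"

lemma next_config_stopped: "stopped \<delta> c \<Longrightarrow> next_config \<delta> c = c"
  by (cases c) simp

text \<open>
  All reasoning about runs goes through the truth value of \<open>halts\<close>: by this invariance a
  phase of a computation is described by an equivalence between the halting of two configurations,
  without counting steps.
\<close>

lemma halts_next_config: "halts \<delta> (next_config \<delta> c) \<longleftrightarrow> halts \<delta> c"
proof
  assume "halts \<delta> (next_config \<delta> c)"
  then obtain n where "stopped \<delta> ((next_config \<delta> ^^ n) (next_config \<delta> c))"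
    unfolding halts_def by blast
  then have "stopped \<delta> ((next_config \<delta> ^^ Suc n) c)"
    by (simp add: funpow_swap1)
  then show "halts \<delta> c" unfolding halts_def by blast
next
  assume "halts \<delta> c"
  then obtain n where n: "stopped \<delta> ((next_config \<delta> ^^ n) c)"
    unfolding halts_def by blast
  then have "stopped \<delta> (next_config \<delta> ((next_config \<delta> ^^ n) c))"
    by (simp add: next_config_stopped)
  then have "stopped \<delta> ((next_config \<delta> ^^ n) (next_config \<delta> c))"
    by (simp add: funpow_swap1)
  then show "halts \<delta> (next_config \<delta> c)" unfolding halts_def by blast
qed

lemma not_halts_if_loops:
  assumes "next_config \<delta> c = c" and "\<not> stopped \<delta> c"
  shows "\<not> halts \<delta> c"
proof -
  have "(next_config \<delta> ^^ n) c = c" for n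
    by (induction n) (auto simp: assms(1))
  then show ?thesis using assms(2) by (simp add: halts_def)
qed

lemma halts_if_stopped: "stopped \<delta> c \<Longrightarrow> halts \<delta> c"
  unfolding halts_def by (metis funpow_0)

lemma stopped_fmlookup: "stopped (fmlookup M) c \<longleftrightarrow> halted M c"
  by (cases c) simp

lemma next_config_fmlookup: "next_config (fmlookup M) = step M"
  by (rule ext) (auto split: option.splits)

lemma halts_fmlookup: "halts (fmlookup M) (init_config n) \<longleftrightarrow> (\<exists>i. halts_within M n i)"
  by (simp add: halts_def halts_within_def stopped_fmlookup next_config_fmlookup)

text \<open>
  The table \<open>\<delta>'\<close> is only described on codes, and a coded configuration never leads elsewhere. This
  leaves room for padding \<open>\<delta>'\<close> with further entries.
\<close>

lemma halts_encoded:
  fixes \<delta> :: "('q, 's) table" and \<delta>' :: "('p, 'r) table"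
  assumes lookup: "\<And>q s. \<delta>' (e q, f s) = map_option (\<lambda>(q', s', d). (e q', f s', d)) (\<delta> (q, s))"
  shows "halts \<delta>' (e q, h, f \<circ> z) \<longleftrightarrow> halts \<delta> (q, h, z)"
proof -
  define E where "E = (\<lambda>(q, h :: int, z :: int \<Rightarrow> 's). (e q, h, f \<circ> z))"
  have stop: "stopped \<delta>' (E c) \<longleftrightarrow> stopped \<delta> c" for c
    by (cases c) (simp add: E_def lookup)
  have "next_config \<delta>' (E c) = E (next_config \<delta> c)" for c
    by (cases c) (auto simp: E_def lookup fun_eq_iff split: option.splits)
  then have "(next_config \<delta>' ^^ n) (E c) = E ((next_config \<delta> ^^ n) c)" for n c
    by (induction n) simp_all
  then have "halts \<delta>' (E c) \<longleftrightarrow> halts \<delta> c" for c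
    by (simp add: halts_def stop)
  from this[of "(q, h, z)"] show ?thesis by (simp add: E_def)
qed

lemma ex_inj_nat_two_values:
  fixes a b :: "'a::countable"
  assumes "a \<noteq> b"
  shows "\<exists>e :: 'a \<Rightarrow> nat. inj e \<and> e a = 0 \<and> e b = 1"
proof -
  define e where "e = (\<lambda>x. if x = a then 0 else if x = b then 1 else to_nat x + 2)"
  have "inj e" by (auto simp: inj_def e_def)
  moreover have "e a = 0" "e b = 1" using assms by (auto simp: e_def)
  ultimately show ?thesis by blast
qed

text \<open>
  The coding of the states leaves the number 1 unused. Adding an entry for this unreachable state
  yields a second machine with the same behaviour, so at least one of the two differs from \<open>M\<^sub>0\<close>.
\<close>

lemma machine_realizing_table:
  fixes \<delta> :: "('q::countable, 's::countable) table"
  assumes fin: "finite (dom \<delta>)" and ne: "b \<noteq> s"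
  shows "\<exists>M. M \<noteq> M\<^sub>0 \<and> (\<forall>n. (\<exists>i. halts_within M n i) \<longleftrightarrow>
      halts \<delta> (q\<^sub>0, 0, \<lambda>j. if 0 \<le> j \<and> j < int n then s else b))"
proof -
  obtain f :: "'s \<Rightarrow> nat" where f: "inj f" "f b = 0" "f s = 1"
    using ex_inj_nat_two_values[OF ne] by blast
  define e :: "'q \<Rightarrow> nat" where "e = (\<lambda>q. if q = q\<^sub>0 then 0 else to_nat q + 2)"
  have e: "inj e" "e q\<^sub>0 = 0" "e q \<noteq> 1" for q
    by (auto simp: e_def inj_def)
  define m where "m = (\<lambda>(p, r). if p \<in> range e \<and> r \<in> range f
      then map_option (\<lambda>(q', s', d). (e q', f s', d)) (\<delta> (inv e p, inv f r)) else None)"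
  have "dom m \<subseteq> (\<lambda>(q, s). (e q, f s)) ` dom \<delta>"
  proof
    fix x assume "x \<in> dom m"
    then obtain p r y where x: "x = (p, r)" and y: "m (p, r) = Some y" by (cases x) auto
    then obtain q t where "p = e q" "r = f t" by (auto simp: m_def split: if_splits)
    moreover from this y have "(q, t) \<in> dom \<delta>" using e f by (auto simp: m_def split: if_splits)
    ultimately show "x \<in> (\<lambda>(q, s). (e q, f s)) ` dom \<delta>" using x by force
  qed
  then have "finite (dom m)" using fin finite_surj by blast
  then have look: "fmlookup (Abs_fmap m) = m" by (simp add: Abs_fmap_inverse)
  have m: "m (e q, f t) = map_option (\<lambda>(q', s', d). (e q', f s', d)) (\<delta> (q, t))" for q t
    using e f by (simp add: m_def)
  have tape: "f \<circ> (\<lambda>j. if 0 \<le> j \<and> j < int n then s else b) = unary_tape n" for n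
    using f by (auto simp: unary_tape_def fun_eq_iff)
  have real: "(\<exists>i. halts_within M n i) \<longleftrightarrow>
      halts \<delta> (q\<^sub>0, 0, \<lambda>j. if 0 \<le> j \<and> j < int n then s else b)"
    if "\<And>q t. fmlookup M (e q, f t) = m (e q, f t)" for M n
  proof -
    have "halts (fmlookup M) (e q\<^sub>0, 0, f \<circ> (\<lambda>j. if 0 \<le> j \<and> j < int n then s else b)) \<longleftrightarrow>
      halts \<delta> (q\<^sub>0, 0, \<lambda>j. if 0 \<le> j \<and> j < int n then s else b)"
      by (rule halts_encoded) (simp only: that m)
    then show ?thesis using e f by (simp only: tape halts_fmlookup[symmetric] init_config_def)
  qed
  define M\<^sub>1 where "M\<^sub>1 = Abs_fmap m"
  define M\<^sub>2 where "M\<^sub>2 = fmupd (1, 0) (1, 0, Stay) M\<^sub>1"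
  have "1 \<notin> range e" using e(3) by force
  then have "m (1, 0) = None" by (simp add: m_def)
  then have "fmlookup M\<^sub>1 (1, 0) \<noteq> fmlookup M\<^sub>2 (1, 0)"
    by (simp add: M\<^sub>1_def M\<^sub>2_def look)
  then have "M\<^sub>1 \<noteq> M\<^sub>2" by auto
  then obtain M where M: "M = M\<^sub>1 \<or> M = M\<^sub>2" "M \<noteq> M\<^sub>0" by blast
  have "fmlookup M\<^sub>1 (e q, f t) = m (e q, f t)" "fmlookup M\<^sub>2 (e q, f t) = m (e q, f t)" for q t
    using e(3)[of q] by (auto simp: M\<^sub>1_def M\<^sub>2_def look)
  then have "fmlookup M (e q, f t) = m (e q, f t)" for q t using M(1) by blast
  then have "\<forall>n. (\<exists>i. halts_within M n i) \<longleftrightarrow>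
      halts \<delta> (q\<^sub>0, 0, \<lambda>j. if 0 \<le> j \<and> j < int n then s else b)" using real by blast
  then show ?thesis using M(2) by blast
qed

section \<open>A machine that halts iff two values of a computable function agree\<close>

text \<open>
  Given a machine \<open>M\<close> for \<open>F\<close>, a machine that halts on \<open>k\<close> iff $F(2k+2) = F(2k)$ is built as follows.
  The tape has two tracks, one for the run of \<open>M\<close> on $2k$ (track \<open>False\<close>) and one for the run on
  $2k+2$ (track \<open>True\<close>); the second run leaves the result of the first one intact. On each
  track a physical cell stores two adjacent cells of the tape of \<open>M\<close>. Therefore no copying is
  needed to double the input: reading the input stroke as ``both tracks contain two strokes''
  turns the numeral of $k$ into two numerals of $2k$. The missing two strokes
  on track \<open>True\<close> are written into the single physical cell to the left of the input.
\<close>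

type_synonym cell = "nat \<times> nat"

fun half :: "bool \<Rightarrow> cell \<Rightarrow> nat" where
  "half False (a, b) = a" | "half True (a, b) = b"

fun put_half :: "bool \<Rightarrow> nat \<Rightarrow> cell \<Rightarrow> cell" where
  "put_half False s (a, b) = (s, b)" | "put_half True s (a, b) = (a, s)"

fun track :: "bool \<Rightarrow> cell \<times> cell \<Rightarrow> cell" where
  "track True (a, b) = a" | "track False (a, b) = b"

fun put_track :: "bool \<Rightarrow> cell \<Rightarrow> cell \<times> cell \<Rightarrow> cell \<times> cell" where
  "put_track True c (a, b) = (c, b)" | "put_track False c (a, b) = (a, c)"

text \<open>
  The first argument says whether the simulated head is on the second half of its physical
  cell. The result is the new half and the move of the physical head.
\<close>

fun half_move :: "bool \<Rightarrow> move \<Rightarrow> bool \<times> move" where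
  "half_move False MoveLeft = (True, MoveLeft)"
| "half_move True MoveLeft = (False, Stay)"
| "half_move False MoveRight = (True, Stay)"
| "half_move True MoveRight = (False, MoveRight)"
| "half_move p Stay = (p, Stay)"

lemma half_move_parity: "fst (half_move (odd h) d) \<longleftrightarrow> odd (h + displacement d)"
  by (cases "odd h"; cases d) auto

lemma half_move_div:
  "h div 2 + displacement (snd (half_move (odd h) d)) = (h + displacement d) div 2"
  by (cases "odd h"; cases d) (simp_all; presburger)+

text \<open>
  \<open>Run t q p\<close> simulates \<open>M\<close> in state \<open>q\<close> on track \<open>t\<close> with the head on half \<open>p\<close>. \<open>Extend\<close> adds two strokes to
  the left of the input on track \<open>True\<close>. The two results are offset by one physical cell, hence the
  comparison carries along, in \<open>Compare c\<close>, the cell of track \<open>True\<close> that was read one step before.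
\<close>

datatype phase = Run bool nat bool | Extend | Compare cell

instance phase :: countable by countable_datatype

text \<open>
  When \<open>M\<close> halts during a \<open>Run\<close> phase, the next phase is started. The comparison loops forever at the
  first difference and halts at the first common blank pair.
\<close>

fun diagonal_table :: "turing_machine \<Rightarrow> (phase, cell \<times> cell) table" where
  "diagonal_table M (Run t q p, z) =
    (case fmlookup M (q, half p (track t z)) of
       Some (q', s, d) \<Rightarrow> Some (Run t q' (fst (half_move p d)),
         put_track t (put_half p s (track t z)) z, snd (half_move p d))
     | None \<Rightarrow> if t then Some (Compare (fst z), z, MoveRight) else Some (Extend, z, MoveLeft))"
| "diagonal_table M (Extend, z) = Some (Run True 0 False, ((1, 1), snd z), Stay)"
| "diagonal_table M (Compare c, z) =
    (if c \<noteq> snd z then Some (Compare c, z, Stay)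
     else if c = (0, 0) then None
     else Some (Compare (fst z), z, MoveRight))"

definition small_cells :: "nat \<Rightarrow> cell set" where
  "small_cells N = {..<N} \<times> {..<N}"

definition small_phases :: "nat \<Rightarrow> phase set" where
  "small_phases N = (\<lambda>(t, q, p). Run t q p) ` (UNIV \<times> {..<N} \<times> UNIV) \<union> {Extend} \<union> Compare ` small_cells N"

text \<open>
  If \<open>M\<close> only ever enters states and writes symbols below \<open>N\<close>, this restriction keeps all the entries
  that matter.
\<close>

definition finite_table :: "turing_machine \<Rightarrow> nat \<Rightarrow> (phase, cell \<times> cell) table" where
  "finite_table M N = diagonal_table M |` (small_phases N \<times> (small_cells N \<times> small_cells N))"

lemma in_small_phases [simp]:
  "Run t q p \<in> small_phases N \<longleftrightarrow> q < N"
  "Extend \<in> small_phases N"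
  "Compare c \<in> small_phases N \<longleftrightarrow> c \<in> small_cells N"
  by (auto simp: small_phases_def image_iff)

lemma finite_dom_finite_table: "finite (dom (finite_table M N))"
  by (auto simp: finite_table_def small_phases_def small_cells_def intro: finite_subset[OF Int_lower2])

text \<open>
  \<open>pack w\<close> is the physical tape whose two tracks represent the tapes \<open>w True\<close> and \<open>w False\<close> of \<open>M\<close>. Track
  \<open>True\<close> is shifted by one physical cell, so that each of the two runs has its origin at 0 in its
  own coordinates although the numeral of $2k+2$ starts at the physical cell $-1$.
\<close>

definition pack :: "(bool \<Rightarrow> int \<Rightarrow> nat) \<Rightarrow> int \<Rightarrow> cell \<times> cell" where
  "pack w = (\<lambda>i. ((w True (2 * i + 2), w True (2 * i + 3)), (w False (2 * i), w False (2 * i + 1))))"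

text \<open>
  The subtraction accounts for the shift of track \<open>True\<close> in \<open>pack\<close>.
\<close>

definition place :: "bool \<Rightarrow> int \<Rightarrow> int" where
  "place t h = h div 2 - (if t then 1 else 0)"

lemma half_track_pack: "half (odd h) (track t (pack w (place t h))) = w t h"
  by (cases t; cases "odd h") (auto simp: pack_def place_def add_ac elim!: oddE evenE)

lemma pack_update:
  "(pack w)(place t h := put_track t (put_half (odd h) s (track t (pack w (place t h)))) (pack w (place t h)))
    = pack (w(t := (w t)(h := s)))"
proof -
  have "h = 2 * (h div 2) + (if odd h then 1 else 0)" by presburger
  then obtain m where "h = 2 * m + (if odd h then 1 else 0)" by blast
  then consider "h = 2 * m" "even h" | "h = 2 * m + 1" "odd h" by (auto split: if_splits)
  then show ?thesis
    by cases (cases t; force simp: pack_def place_def fun_eq_iff; presburger)+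
qed

definition below :: "nat \<Rightarrow> (bool \<Rightarrow> int \<Rightarrow> nat) \<Rightarrow> bool" where
  "below N w \<longleftrightarrow> (\<forall>t i. w t i < N)"

lemma finite_table_pack:
  assumes "below N w" "q \<in> small_phases N"
  shows "finite_table M N (q, pack w i) = diagonal_table M (q, pack w i)"
  using assms by (simp add: finite_table_def below_def small_cells_def pack_def)

text \<open>
  Each step of \<open>M\<close> on track \<open>t\<close> is one step of the simulation. The bound on states and symbols is
  carried through the induction because the table is cut off at \<open>N\<close>.
\<close>

lemma run_phase:
  assumes bound: "\<And>q s q' s' d. fmlookup M (q, s) = Some (q', s', d) \<Longrightarrow> q' < N \<and> s' < N"
    and "q < N" "below N w" and "(step M ^^ n) (q, h, w t) = (q', h', u)"
  shows "below N (w(t := u)) \<and> q' < N \<and>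
    (halts (finite_table M N) (Run t q (odd h), place t h, pack w) \<longleftrightarrow>
     halts (finite_table M N) (Run t q' (odd h'), place t h', pack (w(t := u))))"
  using assms(2-)
proof (induction n arbitrary: q h w)
  case 0
  then have "q' = q" "h' = h" "w(t := u) = w" by (auto simp del: fun_upd_apply)
  then show ?case using 0 by simp
next
  case (Suc n)
  have tab: "finite_table M N (Run t q (odd h), pack w (place t h)) =
    diagonal_table M (Run t q (odd h), pack w (place t h))"
    using Suc.prems by (intro finite_table_pack) auto
  show ?case
  proof (cases "fmlookup M (q, w t h)")
    case None
    then have "step M (q, h, w t) = (q, h, w t)" by simp
    then have "(step M ^^ n) (q, h, w t) = (q', h', u)"
      using Suc.prems(3) by (simp add: funpow_swap1)
    then show ?thesis using Suc.IH Suc.prems by blast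
  next
    case (Some r)
    obtain q1 s d where r: "r = (q1, s, d)" by (cases r)
    define w1 where "w1 = w(t := (w t)(h := s))"
    have small: "q1 < N" "s < N" using bound Some r by auto
    then have below: "below N w1" using Suc.prems(2) by (auto simp: w1_def below_def)
    have "(step M ^^ n) (q1, h + displacement d, w1 t) = (q', h', u)"
      using Suc.prems(3) Some r by (simp add: funpow_swap1 w1_def)
    note IH = Suc.IH[OF small(1) below this]
    have "next_config (finite_table M N) (Run t q (odd h), place t h, pack w) =
      (Run t q1 (odd (h + displacement d)), place t (h + displacement d), pack w1)"
      using Some r half_move_div[of h d]
      by (simp add: tab half_track_pack half_move_parity w1_def pack_update del: fun_upd_apply)
        (simp add: place_def)
    then have "halts (finite_table M N) (Run t q (odd h), place t h, pack w) \<longleftrightarrow>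
      halts (finite_table M N) (Run t q1 (odd (h + displacement d)), place t (h + displacement d), pack w1)"
      by (metis halts_next_config)
    moreover have "w1(t := u) = w(t := u)" by (simp add: w1_def)
    ultimately show ?thesis using IH by simp
  qed
qed

text \<open>
  The invariant \<open>a = b \<or> 2 * i \<le> min a b\<close> says that no difference lies to the left of position \<open>i\<close>: as long as
  the pairs agree and are not blank, either the numerals are equal or both have two strokes there.
  The number of strokes still ahead decreases in each round.
\<close>

lemma compare_phase:
  assumes "2 \<le> N" "w True = unary_tape a" "w False = unary_tape b" "a = b \<or> 2 * i \<le> min a b"
  shows "halts (finite_table M N) (Compare (w True (2 * int i), w True (2 * int i + 1)), int i, pack w)
    \<longleftrightarrow> a = b"
  using assms(4)
proof (induction "a + 1 - i" arbitrary: i rule: less_induct)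
  case less
  let ?c = "\<lambda>i. (w True (2 * int i), w True (2 * int i + 1))"
  let ?b = "(w False (2 * int i), w False (2 * int i + 1))"
  let ?h = "\<lambda>i. (Compare (?c i), int i, pack w)"
  have "w t j < N" for t j using assms(1-3) by (cases t) (auto simp: unary_tape_def)
  then have tab: "finite_table M N (Compare (?c i), pack w (int i)) = diagonal_table M (Compare (?c i), pack w (int i))"
    by (intro finite_table_pack) (auto simp: small_cells_def below_def)
  have snd_pack: "snd (pack w (int i)) = ?b" by (simp add: pack_def)
  have fst_pack: "fst (pack w (int i)) = ?c (Suc i)" by (simp add: pack_def algebra_simps)
  consider "?c i \<noteq> ?b" | "?c i = ?b" "?c i = (0, 0)" | "?c i = ?b" "?c i \<noteq> (0, 0)" by blast
  then show ?case
  proof cases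
    case 1
    then have d: "diagonal_table M (Compare (?c i), pack w (int i)) = Some (Compare (?c i), pack w (int i), Stay)"
      by (simp only: diagonal_table.simps snd_pack if_True simp_thms)
    have "\<not> halts (finite_table M N) (?h i)"
      by (rule not_halts_if_loops) (simp_all only: next_config.simps stopped.simps tab d, auto)
    moreover have "a \<noteq> b" using 1 assms by auto
    ultimately show ?thesis by simp
  next
    case 2
    then have d: "diagonal_table M (Compare (?c i), pack w (int i)) = None"
      by (simp only: diagonal_table.simps snd_pack if_True if_False simp_thms)
    have "stopped (finite_table M N) (?h i)"
      by (simp only: stopped.simps tab d)
    then have "halts (finite_table M N) (?h i)" by (rule halts_if_stopped)
    moreover have "a = b" using 2 less.prems assms(2,3) by (auto simp: unary_tape_def split: if_splits)
    ultimately show ?thesis by simp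
  next
    case 3
    then have d: "diagonal_table M (Compare (?c i), pack w (int i)) = Some (Compare (?c (Suc i)), pack w (int i), MoveRight)"
      by (simp only: diagonal_table.simps snd_pack fst_pack if_False simp_thms)
    have "next_config (finite_table M N) (?h i) = ?h (Suc i)"
      by (simp only: next_config.simps tab d) simp
    then have "halts (finite_table M N) (?h i) \<longleftrightarrow> halts (finite_table M N) (?h (Suc i))"
      by (metis halts_next_config)
    moreover have "a + 1 - Suc i < a + 1 - i"
      using 3 assms(2) by (auto simp: unary_tape_def split: if_splits)
    moreover have "a = b \<or> 2 * Suc i \<le> min a b"
      using 3 assms(2,3) by (auto simp: unary_tape_def split: if_splits)
    ultimately show ?thesis using less.hyps by blast
  qed
qed

text \<open>
  The tapes \<open>w0\<close>, \<open>w1\<close>, \<open>w2\<close>, \<open>w3\<close> in the proof are those at the start, after the run on track \<open>False\<close>, after \<open>Extend\<close>,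
  and after the run on track \<open>True\<close>. Both runs end with the head back at their origin; this is how the
  physical head is known to be at 0, then at $-1$, and finally at 0 for the comparison.
\<close>

lemma diagonal_table_halts:
  assumes M: "computes M F" and "k \<ge> 1"
    and bound: "\<And>q s q' s' d. fmlookup M (q, s) = Some (q', s', d) \<Longrightarrow> q' < N \<and> s' < N" and "2 \<le> N"
  shows "halts (finite_table M N) (Run False 0 False, 0,
      \<lambda>j. if 0 \<le> j \<and> j < int k then ((1, 1), (1, 1)) else ((0, 0), (0, 0)))
    \<longleftrightarrow> F (2 * k + 2) = F (2 * k)"
proof -
  let ?H = "halts (finite_table M N)"
  \<comment> \<open>The numeral on track \<open>True\<close> starts at 2, which leaves room for the two strokes to be added.\<close>
  define w0 :: "bool \<Rightarrow> int \<Rightarrow> nat" where "w0 = (\<lambda>t i. if t then (if 2 \<le> i \<and> i < 2 * int k + 2 then 1 else 0) else unary_tape (2 * k) i)"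
  have start: "(\<lambda>j. if 0 \<le> j \<and> j < int k then ((1, 1), (1, 1)) else ((0, 0), (0, 0))) = pack w0"
    by (auto simp: pack_def w0_def unary_tape_def fun_eq_iff)
  have w0: "below N w0" "w0 False = unary_tape (2 * k)" using \<open>2 \<le> N\<close> by (auto simp: below_def w0_def unary_tape_def)
  have lookup: "finite_table M N (p, pack w i) = diagonal_table M (p, pack w i)"
    if "below N w" "p \<in> small_phases N" for p w i using that by (rule finite_table_pack)
  obtain n q where n: "(step M ^^ n) (init_config (2 * k)) = (q, 0, unary_tape (F (2 * k)))"
    "fmlookup M (q, unary_tape (F (2 * k)) 0) = None"
    using M[unfolded computes_def, rule_format, of "2 * k"] \<open>k \<ge> 1\<close> by auto
  define w1 where "w1 = w0(False := unary_tape (F (2 * k)))"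
  have r1: "below N w1 \<and> q < N \<and> (?H (Run False 0 False, 0, pack w0) \<longleftrightarrow> ?H (Run False q False, 0, pack w1))"
    using run_phase[of M N 0 w0 n 0 False q 0 "unary_tape (F (2 * k))"] bound w0 n(1) \<open>2 \<le> N\<close>
    by (simp add: init_config_def place_def w1_def)
  have h1: "half False (track False (pack w1 0)) = unary_tape (F (2 * k)) 0"
    by (simp add: pack_def w1_def)
  have "finite_table M N (Run False q False, pack w1 0) = Some (Extend, pack w1 0, MoveLeft)"
    using r1 n(2) by (subst lookup) (auto simp: h1)
  then have "next_config (finite_table M N) (Run False q False, 0, pack w1) = (Extend, -1, pack w1)"
    by simp
  then have r2: "?H (Run False q False, 0, pack w1) \<longleftrightarrow> ?H (Extend, -1, pack w1)"
    by (metis halts_next_config)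
  define w2 where "w2 = w1(True := unary_tape (2 * k + 2))"
  have "(pack w1)(-1 := ((1, 1), snd (pack w1 (-1)))) = pack w2"
    by (auto simp: pack_def w2_def w1_def w0_def unary_tape_def fun_eq_iff)
  moreover have "finite_table M N (Extend, pack w1 (-1)) = Some (Run True 0 False, ((1, 1), snd (pack w1 (-1))), Stay)"
    using r1 by (subst lookup) auto
  ultimately have "next_config (finite_table M N) (Extend, -1, pack w1) = (Run True 0 False, -1, pack w2)"
    by simp
  then have r3: "?H (Extend, -1, pack w1) \<longleftrightarrow> ?H (Run True 0 False, -1, pack w2)"
    by (metis halts_next_config)
  obtain n' q' where n': "(step M ^^ n') (init_config (2 * k + 2)) = (q', 0, unary_tape (F (2 * k + 2)))"
    "fmlookup M (q', unary_tape (F (2 * k + 2)) 0) = None"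
    using M[unfolded computes_def, rule_format, of "2 * k + 2"] by auto
  define w3 where "w3 = w2(True := unary_tape (F (2 * k + 2)))"
  have w2: "below N w2" using r1 \<open>2 \<le> N\<close> by (auto simp: below_def w2_def unary_tape_def)
  have r4: "below N w3 \<and> q' < N \<and> (?H (Run True 0 False, -1, pack w2) \<longleftrightarrow> ?H (Run True q' False, -1, pack w3))"
    using run_phase[of M N 0 w2 n' 0 True q' 0 "unary_tape (F (2 * k + 2))"] bound w2 n'(1) \<open>2 \<le> N\<close>
    by (simp add: init_config_def place_def w3_def w2_def)
  have h3: "half False (track True (pack w3 (-1))) = unary_tape (F (2 * k + 2)) 0"
    by (simp add: pack_def w3_def)
  have w3: "w3 True = unary_tape (F (2 * k + 2))" "w3 False = unary_tape (F (2 * k))"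
    by (simp_all add: w3_def w2_def w1_def)
  have f3: "fst (pack w3 (-1)) = (w3 True 0, w3 True 1)" by (simp add: pack_def)
  have "finite_table M N (Run True q' False, pack w3 (-1)) =
    Some (Compare (w3 True 0, w3 True 1), pack w3 (-1), MoveRight)"
    using r4 n'(2) by (subst lookup) (auto simp: h3 f3)
  then have "next_config (finite_table M N) (Run True q' False, -1, pack w3) =
    (Compare (w3 True 0, w3 True 1), 0, pack w3)" by simp
  then have r5: "?H (Run True q' False, -1, pack w3) \<longleftrightarrow> ?H (Compare (w3 True 0, w3 True 1), 0, pack w3)"
    by (metis halts_next_config)
  have "?H (Compare (w3 True 0, w3 True 1), 0, pack w3) \<longleftrightarrow> F (2 * k + 2) = F (2 * k)"
    using compare_phase[OF \<open>2 \<le> N\<close> w3, of 0] by simp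
  then show ?thesis using r1 r2 r3 r4 r5 by (simp only: start)
qed

text \<open>
  Only the finitely many states and symbols that occur in results of the table of \<open>M\<close>, together with
  the initial ones, can appear in a run, which provides the bound at which the table is cut off.
\<close>

lemma machine_detecting_equal_values:
  assumes "computable F"
  shows "\<exists>D. D \<noteq> M\<^sub>0 \<and> (\<forall>k\<ge>1. (\<exists>i. halts_within D k i) \<longleftrightarrow> F (2 * k + 2) = F (2 * k))"
proof -
  obtain M where M: "computes M F" using assms unfolding computable_def by blast
  define A where "A = fst ` fmran' M \<union> (fst \<circ> snd) ` fmran' M"
  have "finite A" by (simp add: A_def fmran'_alt_def)
  define N where "N = Suc (Max (insert 1 A))"
  have "2 \<le> N" "a \<in> A \<Longrightarrow> a < N" for a
    using \<open>finite A\<close> Max_ge[of "insert 1 A" 1] Max_ge[of "insert 1 A" a] by (auto simp: N_def less_Suc_eq_le)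
  moreover have "q' \<in> A \<and> s' \<in> A" if "fmlookup M (q, s) = Some (q', s', d)" for q s q' s' d
    using fmran'I[OF that] by (force simp: A_def)
  ultimately have bound: "q' < N \<and> s' < N" if "fmlookup M (q, s) = Some (q', s', d)" for q s q' s' d
    using that by blast
  have halts: "halts (finite_table M N) (Run False 0 False, 0,
      \<lambda>j. if 0 \<le> j \<and> j < int k then ((1, 1), (1, 1)) else ((0, 0), (0, 0)))
    \<longleftrightarrow> F (2 * k + 2) = F (2 * k)" if "1 \<le> k" for k
    by (rule diagonal_table_halts[OF M that _ \<open>2 \<le> N\<close>]) (rule bound)
  have "((0, 0), (0, 0)) \<noteq> ((1, 1), (1, 1) :: cell)" by simp
  from machine_realizing_table[OF finite_dom_finite_table[of M N] this, of M\<^sub>0 "Run False 0 False"]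
  obtain D where D: "D \<noteq> M\<^sub>0" and eq: "\<And>n. (\<exists>i. halts_within D n i) \<longleftrightarrow>
      halts (finite_table M N) (Run False 0 False, 0,
        \<lambda>j. if 0 \<le> j \<and> j < int n then ((1, 1), (1, 1)) else ((0, 0), (0, 0)))" by blast
  have "(\<exists>i. halts_within D k i) \<longleftrightarrow> F (2 * k + 2) = F (2 * k)" if "1 \<le> k" for k
    unfolding eq by (rule halts[OF that])
  then show ?thesis using D by blast
qed

section \<open>Scalar equations and periodic orbits of radial fields\<close>

text \<open>
  The integrating factor \<open>exp (- A)\<close>, where \<open>A\<close> is an antiderivative of \<open>a\<close>, turns \<open>z\<close> into a constant.
\<close>

lemma linear_ode_vanishes:
  fixes z a :: "real \<Rightarrow> real"
  assumes z: "\<And>s. s \<in> {l..r} \<Longrightarrow> (z has_real_derivative a s * z s) (at s within {l..r})"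
    and a: "continuous_on {l..r} a"
    and "s\<^sub>0 \<in> {l..r}" "z s\<^sub>0 = 0" "s \<in> {l..r}"
  shows "z s = 0"
proof -
  obtain A where A: "\<And>s. s \<in> {l..r} \<Longrightarrow> (A has_vector_derivative a s) (at s within {l..r})"
    using antiderivative_continuous[OF a] by blast
  have "((\<lambda>s. z s * exp (- A s)) has_real_derivative 0) (at s within {l..r})" if s: "s \<in> {l..r}" for s
  proof -
    have "(A has_real_derivative a s) (at s within {l..r})"
      using A[OF s] by (simp add: has_real_derivative_iff_has_vector_derivative)
    then show ?thesis
      using z[OF s] by (auto intro!: derivative_eq_intros)
  qed
  then have "\<exists>k. \<forall>s\<in>{l..r}. z s * exp (- A s) = k"
    by (intro has_field_derivative_zero_constant) auto
  then have "z s * exp (- A s) = z s\<^sub>0 * exp (- A s\<^sub>0)" using assms(3,5) by metis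
  then show ?thesis using \<open>z s\<^sub>0 = 0\<close> by simp
qed

text \<open>
  With an antiderivative \<open>H\<close> of \<open>Q\<close>, the function \<open>H \<circ> w\<close> has derivative $Q(w)^2 \ge 0$ and equal values
  at both ends, so it is constant and its derivative vanishes.
\<close>

lemma scalar_ode_return_stationary:
  fixes w Q :: "real \<Rightarrow> real"
  assumes "T > 0" and w: "\<And>s. s \<in> {0..T} \<Longrightarrow> (w has_real_derivative Q (w s)) (at s within {0..T})"
    and Q: "continuous_on UNIV Q" and "w T = w 0"
  shows "Q (w 0) = 0"
proof -
  have "continuous_on {0..T} w"
    using w by (meson DERIV_continuous continuous_on_eq_continuous_within)
  then have "compact (w ` {0..T})" by (intro compact_continuous_image) auto
  then have "bounded (w ` {0..T})" by (rule compact_imp_bounded)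
  then obtain b where "\<And>s. s \<in> {0..T} \<Longrightarrow> \<bar>w s\<bar> \<le> b"
    unfolding bounded_real by blast
  \<comment> \<open>The antiderivative of \<open>Q\<close> is only needed on an interval that contains the values of \<open>w\<close>.\<close>
  then have sub: "w ` {0..T} \<subseteq> {-b..b}" by (auto simp: abs_le_iff minus_le_iff)
  obtain H where H: "\<And>x. x \<in> {-b..b} \<Longrightarrow> (H has_vector_derivative Q x) (at x within {-b..b})"
    using antiderivative_continuous[of "-b" b Q] continuous_on_subset[OF Q] by (metis subset_UNIV)
  have HD: "((\<lambda>s. H (w s)) has_real_derivative (Q (w s))\<^sup>2) (at s within {0..T})" if s: "s \<in> {0..T}" for s
  proof -
    have "(H has_vector_derivative Q (w s)) (at (w s) within w ` {0..T})"
      using H sub s by (meson has_vector_derivative_within_subset image_subset_iff)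
    from vector_diff_chain_within[OF w[OF s, unfolded has_real_derivative_iff_has_vector_derivative] this]
    show ?thesis by (simp add: has_real_derivative_iff_has_vector_derivative o_def power2_eq_square)
  qed
  have mono: "H (w s) \<le> H (w t)" if "0 \<le> s" "s \<le> t" "t \<le> T" for s t
  proof (rule DERIV_nonneg_imp_increasing_open[OF that(2)])
    fix x assume "s < x" "x < t"
    then have "at x within {0..T} = at x" using that by (intro at_within_Icc_at) auto
    then show "\<exists>y. ((\<lambda>s. H (w s)) has_real_derivative y) (at x) \<and> 0 \<le> y"
      using HD[of x] that \<open>s < x\<close> \<open>x < t\<close> by (intro exI[of _ "(Q (w x))\<^sup>2"]) auto
  next
    have "continuous_on {0..T} (\<lambda>s. H (w s))"
      using HD by (meson DERIV_continuous continuous_on_eq_continuous_within)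
    then show "continuous_on {s..t} (\<lambda>s. H (w s))"
      by (rule continuous_on_subset) (use that in auto)
  qed
  have const: "H (w s) = H (w 0)" if "s \<in> {0..T}" for s
    using mono[of 0 s] mono[of s T] that \<open>w T = w 0\<close> by auto
  have "((\<lambda>s. H (w s)) has_real_derivative 0) (at 0 within {0..T})"
  proof (rule has_field_derivative_transform_within[where d = 1])
    show "((\<lambda>_. H (w 0)) has_real_derivative 0) (at 0 within {0..T})" by (rule DERIV_const)
    show "H (w 0) = H (w s)" if "s \<in> {0..T}" for s using const[OF that] by simp
  qed (use \<open>T > 0\<close> in auto)
  moreover have "((\<lambda>s. H (w s)) has_real_derivative (Q (w 0))\<^sup>2) (at 0 within {0..T})"
    using HD \<open>T > 0\<close> by simp
  ultimately have "(Q (w 0))\<^sup>2 = 0"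
    using \<open>T > 0\<close> vector_derivative_unique_within_closed_interval[of 0 T 0 "\<lambda>s. H (w s)" "(Q (w 0))\<^sup>2" 0]
    by (simp add: has_real_derivative_iff_has_vector_derivative)
  then show ?thesis by simp
qed

definition radial_field :: "(real \<Rightarrow> real) \<Rightarrow> real \<times> real \<Rightarrow> real \<times> real" where
  "radial_field P = (\<lambda>(x, y). (- y + x * P (x\<^sup>2 + y\<^sup>2), x + y * P (x\<^sup>2 + y\<^sup>2)))"

definition square_norm :: "real \<times> real \<Rightarrow> real" where
  "square_norm z = (fst z)\<^sup>2 + (snd z)\<^sup>2"

definition circle :: "real \<Rightarrow> (real \<times> real) set" where
  "circle c = {z. square_norm z = c}"

lemma square_norm_derivative:
  assumes "(u has_vector_derivative radial_field P (u s)) (at s within A)"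
  shows "((\<lambda>s. square_norm (u s)) has_real_derivative
    2 * square_norm (u s) * P (square_norm (u s))) (at s within A)"
proof -
  define x y where "x = fst \<circ> u" and "y = snd \<circ> u"
  have d: "(x has_real_derivative fst (radial_field P (u s))) (at s within A)"
    "(y has_real_derivative snd (radial_field P (u s))) (at s within A)"
    using bounded_linear.has_vector_derivative[OF bounded_linear_fst assms]
      bounded_linear.has_vector_derivative[OF bounded_linear_snd assms]
    by (simp_all add: has_real_derivative_iff_has_vector_derivative x_def y_def o_def)
  have "((\<lambda>s. (x s)\<^sup>2 + (y s)\<^sup>2) has_real_derivative
    2 * (x s * fst (radial_field P (u s)) + y s * snd (radial_field P (u s)))) (at s within A)"
    by (auto intro!: derivative_eq_intros d simp: algebra_simps)
  also have "2 * (x s * fst (radial_field P (u s)) + y s * snd (radial_field P (u s))) =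
    2 * square_norm (u s) * P (square_norm (u s))"
    by (simp add: radial_field_def square_norm_def x_def y_def case_prod_beta algebra_simps power2_eq_square)
  finally show ?thesis by (simp add: square_norm_def x_def y_def)
qed

text \<open>
  The squared radius is an equilibrium of its scalar equation. That solutions do not leave
  an equilibrium follows from the linear equation satisfied by $w - c$, whose coefficient $2wR(w)$
  is continuous in time.
\<close>

lemma circle_invariant:
  assumes P: "\<And>s. P s = (s - c) * R s" and R: "continuous_on UNIV R"
    and "square_norm x = c" "flows_to (radial_field P) t x y"
  shows "square_norm y = c"
proof -
  obtain u where u: "u 0 = x" "u t = y"
    and du: "\<And>s. s \<in> closed_segment 0 t \<Longrightarrow>
      (u has_vector_derivative radial_field P (u s)) (at s within closed_segment 0 t)"
    using assms(4) unfolding flows_to_def by blast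
  define l r where "l = min 0 t" and "r = max 0 t"
  \<comment> \<open>Both signs of \<open>t\<close> are treated at once.\<close>
  have seg: "closed_segment 0 t = {l..r}" by (auto simp: l_def r_def closed_segment_eq_real_ivl)
  define w where "w = (\<lambda>s. square_norm (u s))"
  have dw: "(w has_real_derivative 2 * w s * P (w s)) (at s within {l..r})" if "s \<in> {l..r}" for s
    using square_norm_derivative[OF du, of s] that unfolding seg w_def by simp
  then have cw: "continuous_on {l..r} w"
    by (meson DERIV_continuous continuous_on_eq_continuous_within)
  have "w t - c = 0"
  proof (rule linear_ode_vanishes[of l r "\<lambda>s. w s - c" "\<lambda>s. 2 * w s * R (w s)" 0 t])
    fix s assume "s \<in> {l..r}"
    from dw[OF this] show "((\<lambda>s. w s - c) has_real_derivative 2 * w s * R (w s) * (w s - c)) (at s within {l..r})"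
      by (auto intro!: derivative_eq_intros simp: P)
  next
    show "continuous_on {l..r} (\<lambda>s. 2 * w s * R (w s))"
      using cw by (auto intro!: continuous_intros continuous_on_compose2[OF R])
  qed (use u assms(3) in \<open>auto simp: l_def r_def w_def\<close>)
  then show ?thesis using u by (simp add: w_def)
qed

text \<open>
  Where \<open>P\<close> vanishes, the field is the generator of the rotations.
\<close>

lemma flows_to_rotation:
  assumes "P (square_norm (x, y)) = 0"
  shows "flows_to (radial_field P) t (x, y) (x * cos t - y * sin t, x * sin t + y * cos t)"
proof -
  define u where "u = (\<lambda>t. (x * cos t - y * sin t, x * sin t + y * cos t))"
  have "(fst (u t))\<^sup>2 + (snd (u t))\<^sup>2 = square_norm (x, y)" for t
  proof -
    have "(fst (u t))\<^sup>2 + (snd (u t))\<^sup>2 = (x\<^sup>2 + y\<^sup>2) * ((sin t)\<^sup>2 + (cos t)\<^sup>2)"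
      unfolding u_def fst_conv snd_conv by algebra
    then show ?thesis by (simp add: square_norm_def)
  qed
  then have p: "radial_field P (u t) = (- snd (u t), fst (u t))" for t
    using assms by (simp add: radial_field_def case_prod_beta)
  have "(u has_vector_derivative radial_field P (u s)) (at s within A)" for s A
    unfolding p unfolding u_def fst_conv snd_conv
    by (intro has_vector_derivative_Pair; unfold has_real_derivative_iff_has_vector_derivative[symmetric])
      (auto intro!: derivative_eq_intros)
  moreover have "u 0 = (x, y)" by (simp add: u_def)
  moreover have "u t = (x * cos t - y * sin t, x * sin t + y * cos t)" by (simp add: u_def)
  ultimately show ?thesis unfolding flows_to_def by (intro exI[of _ u]) simp
qed

lemma trajectory_circle:
  assumes P: "\<And>s. P s = (s - c) * R s" and R: "continuous_on UNIV R"
    and "square_norm z = c" "c > 0"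
  shows "trajectory (radial_field P) z = circle c"
proof (intro equalityI subsetI)
  fix y assume "y \<in> trajectory (radial_field P) z"
  then obtain t where "flows_to (radial_field P) t z y" unfolding trajectory_def by blast
  from circle_invariant[OF P R \<open>square_norm z = c\<close> this] show "y \<in> circle c"
    by (simp add: circle_def)
next
  fix v assume "v \<in> circle c"
  obtain x y where z: "z = (x, y)" by (cases z)
  obtain a b where v: "v = (a, b)" by (cases v)
  have xy: "x\<^sup>2 + y\<^sup>2 = c" and ab: "a\<^sup>2 + b\<^sup>2 = c"
    using \<open>v \<in> circle c\<close> \<open>square_norm z = c\<close> by (auto simp: z v circle_def square_norm_def)
  have "(x * a + y * b)\<^sup>2 + (x * b - y * a)\<^sup>2 = (x\<^sup>2 + y\<^sup>2) * (a\<^sup>2 + b\<^sup>2)"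
    by algebra
  then have "((x * a + y * b) / c)\<^sup>2 + ((x * b - y * a) / c)\<^sup>2 = 1"
    using \<open>c > 0\<close> unfolding xy ab by (simp add: power_divide add_divide_distrib[symmetric]) (simp add: power2_eq_square)
  then obtain t where t: "(x * a + y * b) / c = cos t" "(x * b - y * a) / c = sin t"
    using sincos_total_2pi by metis
  have "c * (x * cos t - y * sin t) = (x\<^sup>2 + y\<^sup>2) * a" "c * (x * sin t + y * cos t) = (x\<^sup>2 + y\<^sup>2) * b"
    unfolding t[symmetric] using \<open>c > 0\<close> by (simp_all add: field_simps power2_eq_square)
  then have "v = (x * cos t - y * sin t, x * sin t + y * cos t)"
    using \<open>c > 0\<close> by (simp add: v xy)
  moreover have "P (square_norm (x, y)) = 0" using P \<open>square_norm z = c\<close> z by simp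
  ultimately show "v \<in> trajectory (radial_field P) z"
    using flows_to_rotation[of P x y t] z unfolding trajectory_def by auto
qed

lemma self_in_trajectory: "x \<in> trajectory p x"
proof -
  have "((\<lambda>_. x) has_vector_derivative p x) (at 0 within {0})"
    by (simp add: has_vector_derivative_def has_derivative_within_singleton_iff bounded_linear_scaleR_left)
  then have "flows_to p 0 x x"
    unfolding flows_to_def by (intro exI[of _ "\<lambda>_. x"]) simp
  then show ?thesis unfolding trajectory_def by blast
qed

text \<open>
  A periodic orbit stays on one circle by applying \<open>scalar_ode_return_stationary\<close> to the squared
  radius, and conversely each of the circles is a single trajectory with period $2\pi$.
  The product form of \<open>P\<close> makes it possible to split off the factor that vanishes at a given zero.
\<close>

lemma periodic_orbits_radial_field:
  assumes "finite J" and P: "P = (\<lambda>s. \<Prod>j\<in>J. s - S j)"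
  shows "periodic_orbits (radial_field P) = circle ` {c. c > 0 \<and> c \<in> S ` J}"
proof (intro equalityI subsetI)
  have factor: "\<exists>R. (\<forall>s. P s = (s - c) * R s) \<and> continuous_on UNIV R" if c: "c \<in> S ` J" for c
  proof -
    obtain j where "j \<in> J" "c = S j" using c by blast
    then have "\<forall>s. P s = (s - c) * (\<Prod>j\<in>J - {j}. s - S j)"
      using \<open>finite J\<close> by (simp add: P prod.remove)
    moreover have "continuous_on UNIV (\<lambda>s. \<Prod>j\<in>J - {j}. s - S j)"
      by (intro continuous_intros)
    ultimately show ?thesis by (intro exI[of _ "\<lambda>s. \<Prod>j\<in>J - {j}. s - S j"]) simp
  qed
  have zero: "P c = 0 \<longleftrightarrow> c \<in> S ` J" for c using \<open>finite J\<close> by (auto simp: P)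
  { fix \<gamma> assume "\<gamma> \<in> periodic_orbits (radial_field P)"
    then obtain z T where z: "radial_field P z \<noteq> 0" and \<gamma>: "\<gamma> = trajectory (radial_field P) z"
      and T: "T > 0" "flows_to (radial_field P) T z z"
      unfolding periodic_orbits_def periodic_orbit_def using self_in_trajectory by blast
    define c where "c = square_norm z"
    have "z \<noteq> 0" using z by (auto simp: radial_field_def zero_prod_def)
    then have "c > 0" by (cases z) (auto simp: c_def square_norm_def zero_prod_def sum_power2_gt_zero_iff)
    obtain u where u: "u 0 = z" "u T = z"
      and du: "\<And>s. s \<in> closed_segment 0 T \<Longrightarrow>
        (u has_vector_derivative radial_field P (u s)) (at s within closed_segment 0 T)"
      using T(2) unfolding flows_to_def by blast
    have seg: "closed_segment 0 T = {0..T}" using T by (simp add: closed_segment_eq_real_ivl)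
    have "2 * square_norm (u 0) * P (square_norm (u 0)) = 0"
    proof (rule scalar_ode_return_stationary[OF T(1), of "\<lambda>s. square_norm (u s)" "\<lambda>w. 2 * w * P w"])
      show "continuous_on UNIV (\<lambda>w. 2 * w * P w)" unfolding P by (intro continuous_intros)
      show "((\<lambda>s. square_norm (u s)) has_real_derivative 2 * square_norm (u s) * P (square_norm (u s)))
        (at s within {0..T})" if "s \<in> {0..T}" for s
        using square_norm_derivative[OF du, of s] that seg by simp
    qed (simp add: u)
    then have "c \<in> S ` J" using \<open>c > 0\<close> zero by (simp add: u c_def)
    moreover from factor[OF this] have "\<gamma> = circle c"
      unfolding \<gamma> using trajectory_circle \<open>c > 0\<close> c_def by metis
    ultimately show "\<gamma> \<in> circle ` {c. c > 0 \<and> c \<in> S ` J}" using \<open>c > 0\<close> by blast }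
  { fix \<gamma> assume "\<gamma> \<in> circle ` {c. c > 0 \<and> c \<in> S ` J}"
    then obtain c where c: "c > 0" "c \<in> S ` J" and \<gamma>: "\<gamma> = circle c" by blast
    have norm: "square_norm (sqrt c, 0) = c" using c by (simp add: square_norm_def)
    have "trajectory (radial_field P) (sqrt c, 0) = \<gamma>"
      unfolding \<gamma> using factor[OF c(2)] trajectory_circle[OF _ _ norm c(1)] by metis
    moreover have "radial_field P (sqrt c, 0) \<noteq> 0" using c by (simp add: radial_field_def zero_prod_def)
    moreover have "flows_to (radial_field P) (2 * pi) z z" if "z \<in> \<gamma>" for z
      using flows_to_rotation[of P "fst z" "snd z" "2 * pi"] that zero c(2) by (simp add: \<gamma> circle_def)
    ultimately have "\<exists>x. radial_field P x \<noteq> 0 \<and> \<gamma> = trajectory (radial_field P) x"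
      and "\<forall>z\<in>\<gamma>. flows_to (radial_field P) (2 * pi) z z" by blast+
    then show "\<gamma> \<in> periodic_orbits (radial_field P)"
      unfolding periodic_orbits_def periodic_orbit_def using pi_gt_zero
      by (intro CollectI conjI exI[of _ "2 * pi"]) simp_all }
qed

lemma inj_on_circle: "inj_on circle {0..}"
proof (rule inj_onI)
  fix c d :: real assume "c \<in> {0..}" and eq: "circle c = circle d"
  from \<open>c \<in> {0..}\<close> have "(sqrt c, 0) \<in> circle c" by (simp add: circle_def square_norm_def)
  then have "(sqrt c, 0) \<in> circle d" using eq by simp
  then show "c = d" using \<open>c \<in> {0..}\<close> by (simp add: circle_def square_norm_def)
qed

section \<open>Degrees\<close>

lemma finite_exponents: "finite {(i, j). i + j \<le> (n::nat)}"
  by (rule finite_subset[of _ "{..n} \<times> {..n}"]) auto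

lemma polynomial_degree_le_const: "polynomial_degree_le 0 (\<lambda>_. c)"
proof -
  have "{(i, j). i + j \<le> (0::nat)} = {(0, 0)}" by auto
  then show ?thesis unfolding polynomial_degree_le_def by (intro exI[of _ "\<lambda>_ _. c"]) simp
qed

lemma polynomial_degree_le_add:
  assumes "polynomial_degree_le n f" "polynomial_degree_le n f'"
  shows "polynomial_degree_le n (\<lambda>z. f z + f' z)"
proof -
  obtain a b where "\<And>x y. f (x, y) = (\<Sum>(i, j)\<in>{(i, j). i + j \<le> n}. a i j * x ^ i * y ^ j)"
    "\<And>x y. f' (x, y) = (\<Sum>(i, j)\<in>{(i, j). i + j \<le> n}. b i j * x ^ i * y ^ j)"
    using assms unfolding polynomial_degree_le_def by blast
  then have "f (x, y) + f' (x, y) =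
    (\<Sum>(i, j)\<in>{(i, j). i + j \<le> n}. (a i j + b i j) * x ^ i * y ^ j)" for x y
    by (simp add: sum.distrib[symmetric] case_prod_beta algebra_simps)
  then show ?thesis unfolding polynomial_degree_le_def by (intro exI[of _ "\<lambda>i j. a i j + b i j"]) simp
qed

text \<open>
  Coefficients move from \<open>(i, j)\<close> to \<open>(i + p, j + q)\<close>. With \<open>p = q = 0\<close> and \<open>c = 1\<close> this is monotonicity in
  the degree bound.
\<close>

lemma polynomial_degree_le_mult_monomial:
  assumes "polynomial_degree_le n f" "n + p + q \<le> m"
  shows "polynomial_degree_le m (\<lambda>z. c * fst z ^ p * snd z ^ q * f z)"
proof -
  obtain a where a: "\<And>x y. f (x, y) = (\<Sum>(i, j)\<in>{(i, j). i + j \<le> n}. a i j * x ^ i * y ^ j)"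
    using assms unfolding polynomial_degree_le_def by blast
  define s where "s = (\<lambda>(i, j). (i + p, j + q))"
  define b where "b = (\<lambda>i j. if (i, j) \<in> s ` {(i, j). i + j \<le> n} then c * a (i - p) (j - q) else 0)"
  have "c * x ^ p * y ^ q * f (x, y) = (\<Sum>(i, j)\<in>{(i, j). i + j \<le> m}. b i j * x ^ i * y ^ j)" for x y
  proof -
    have "(\<Sum>(i, j)\<in>{(i, j). i + j \<le> m}. b i j * x ^ i * y ^ j) =
        (\<Sum>(i, j)\<in>s ` {(i, j). i + j \<le> n}. b i j * x ^ i * y ^ j)"
      using assms(2) by (intro sum.mono_neutral_right finite_exponents) (auto simp: s_def b_def)
    also have "\<dots> = (\<Sum>z\<in>{(i, j). i + j \<le> n}. (\<lambda>(i, j). b i j * x ^ i * y ^ j) (s z))"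
      by (subst sum.reindex) (auto simp: inj_on_def s_def)
    also have "\<dots> = (\<Sum>(i, j)\<in>{(i, j). i + j \<le> n}. c * x ^ p * y ^ q * (a i j * x ^ i * y ^ j))"
    proof (rule sum.cong[OF refl])
      fix z assume z: "z \<in> {(i, j). i + j \<le> n}"
      obtain i j where ij: "z = (i, j)" by (cases z)
      have "(i + p, j + q) \<in> s ` {(i, j). i + j \<le> n}" using z ij by (force simp: s_def)
      then show "(case s z of (i, j) \<Rightarrow> b i j * x ^ i * y ^ j) =
        (case z of (i, j) \<Rightarrow> c * x ^ p * y ^ q * (a i j * x ^ i * y ^ j))"
        by (simp add: ij s_def b_def power_add)
    qed
    also have "\<dots> = c * x ^ p * y ^ q * f (x, y)"
      by (simp add: a sum_distrib_left case_prod_beta)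
    finally show ?thesis by simp
  qed
  then show ?thesis unfolding polynomial_degree_le_def by (intro exI[of _ b]) simp
qed

lemma polynomial_degree_le_prod_circles:
  assumes "finite J"
  shows "polynomial_degree_le (2 * card J) (\<lambda>z. \<Prod>j\<in>J. (fst z)\<^sup>2 + (snd z)\<^sup>2 - S j)"
  using assms
proof induction
  case empty
  then show ?case by (simp add: polynomial_degree_le_const)
next
  case (insert j J)
  let ?f = "\<lambda>z. \<Prod>j\<in>J. (fst z)\<^sup>2 + (snd z)\<^sup>2 - S j"
  have mono: "polynomial_degree_le (2 * card J + 2) (\<lambda>z. c * fst z ^ p * snd z ^ q * ?f z)"
    if "p + q \<le> 2" for c p q
    using that by (intro polynomial_degree_le_mult_monomial[OF insert.IH]) simp
  have "polynomial_degree_le (2 * card J + 2)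
    (\<lambda>z. (1 * fst z ^ 2 * snd z ^ 0 * ?f z + 1 * fst z ^ 0 * snd z ^ 2 * ?f z) + (- S j) * fst z ^ 0 * snd z ^ 0 * ?f z)"
    by (intro polynomial_degree_le_add mono) simp_all
  then show ?case using insert.hyps by (simp add: algebra_simps)
qed

text \<open>
  A lower bound for the total degree is read off from the restriction to the first axis.
\<close>

lemma degree_le_of_polynomial_degree_le:
  fixes P :: "real poly"
  assumes "polynomial_degree_le n f" and P: "\<And>x. f (x, 0) = poly P x"
  shows "degree P \<le> n"
proof -
  obtain a where a: "\<And>x y. f (x, y) = (\<Sum>(i, j)\<in>{(i, j). i + j \<le> n}. a i j * x ^ i * y ^ j)"
    using assms unfolding polynomial_degree_le_def by blast
  define Q where "Q = (\<Sum>z\<in>{(i, j). i + j \<le> n}. monom (a (fst z) (snd z) * 0 ^ snd z) (fst z))"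
  have "poly P = poly Q"
    by (rule ext) (simp add: P[symmetric] a Q_def poly_sum poly_monom case_prod_beta mult_ac)
  moreover have "degree Q \<le> n"
    unfolding Q_def by (intro degree_sum_le finite_exponents) (auto intro: order_trans[OF degree_monom_le])
  ultimately show ?thesis by (simp add: poly_eq_poly_eq_iff)
qed

lemma components_degree_le_halting_family:
  "components_degree_le n (halting_family TM k) \<longleftrightarrow> 2 * k + 1 \<le> n"
proof
  define S where "S = (\<lambda>j. \<Sum>i=1..j. real i * G TM i)"
  define P where "P = (\<Prod>j=1..k. [:- S j, 0, 1:])"
  assume "components_degree_le n (halting_family TM k)"
  then have "polynomial_degree_le n (\<lambda>z. fst (halting_family TM k z))"
    by (simp add: components_degree_le_def)
  then have "degree (pCons 0 P) \<le> n"
    by (rule degree_le_of_polynomial_degree_le)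
      (simp add: halting_family_def P_def S_def poly_prod power2_eq_square)
  moreover have "degree P = 2 * k" unfolding P_def by (subst degree_prod_eq_sum_degree) auto
  moreover have "P \<noteq> 0" by (auto simp: P_def)
  ultimately show "2 * k + 1 \<le> n" by simp
next
  assume n: "2 * k + 1 \<le> n"
  define f where "f = (\<lambda>z :: real \<times> real. \<Prod>j=1..k. (fst z)\<^sup>2 + (snd z)\<^sup>2 - (\<Sum>i=1..j. real i * G TM i))"
  have f: "polynomial_degree_le (2 * k) f"
    using polynomial_degree_le_prod_circles[of "{1..k}"] by (simp add: f_def)
  have linear: "polynomial_degree_le n (\<lambda>z. c * fst z ^ p * snd z ^ q * 1)" if "p + q \<le> n" for c p q
    using that by (intro polynomial_degree_le_mult_monomial[OF polynomial_degree_le_const]) simp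
  have product: "polynomial_degree_le n (\<lambda>z. 1 * fst z ^ p * snd z ^ q * f z)" if "p + q \<le> 1" for p q
    using that n by (intro polynomial_degree_le_mult_monomial[OF f]) simp
  \<comment> \<open>All the summands are written as a monomial times a function, the form the two facts above expect.\<close>
  have "polynomial_degree_le n (\<lambda>z. (- 1) * fst z ^ 0 * snd z ^ 1 * 1 + 1 * fst z ^ 1 * snd z ^ 0 * f z)"
    using n by (intro polynomial_degree_le_add linear product) simp_all
  moreover have "polynomial_degree_le n (\<lambda>z. 1 * fst z ^ 1 * snd z ^ 0 * 1 + 1 * fst z ^ 0 * snd z ^ 1 * f z)"
    using n by (intro polynomial_degree_le_add linear product) simp_all
  ultimately show "components_degree_le n (halting_family TM k)"
    by (simp add: components_degree_le_def halting_family_def f_def case_prod_beta)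
qed

section \<open>Counting the periodic orbits of the family\<close>

lemma halts_within_Suc: "halts_within M n i \<Longrightarrow> halts_within M n (Suc i)"
  using next_config_stopped[of "fmlookup M"]
  by (simp add: halts_within_def stopped_fmlookup next_config_fmlookup)

text \<open>
  The terms of the series are nonnegative, so it is positive iff one of them is. The series starts
  at one step; a machine that halts at once is covered because halting persists.
\<close>

lemma G_nonneg: "0 \<le> G TM k" and G_pos_iff: "0 < G TM k \<longleftrightarrow> (\<exists>i. halts_within (TM k) k i)"
proof -
  let ?a = "\<lambda>i. g TM k (Suc i) / 2 ^ (Suc i + 1)"
  have a: "0 \<le> ?a i" "?a i \<le> (1 / 2) ^ i" for i
    by (auto simp: g_def field_simps power_add)
  have "norm (?a i) \<le> (1 / 2) ^ i" for i
    using a[of i] by (simp only: real_norm_def abs_of_nonneg)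
  moreover have "summable (\<lambda>i. (1 / 2 :: real) ^ i)" by (rule summable_geometric) simp
  ultimately have "summable ?a" by (rule summable_comparison_test'[rotated])
  note suminf_nonneg[OF this a(1)] suminf_pos_iff[OF this a(1)]
  moreover have "(\<exists>i. 0 < ?a i) \<longleftrightarrow> (\<exists>i. halts_within (TM k) k i)"
  proof -
    have "0 < ?a i \<longleftrightarrow> halts_within (TM k) k (Suc i)" for i by (simp add: g_def)
    then show ?thesis using halts_within_Suc by blast
  qed
  ultimately show "0 \<le> G TM k" "0 < G TM k \<longleftrightarrow> (\<exists>i. halts_within (TM k) k i)"
    by (simp_all add: G_def)
qed

definition radius_square :: "(nat \<Rightarrow> turing_machine) \<Rightarrow> nat \<Rightarrow> real" where
  "radius_square TM j = (\<Sum>i=1..j. real i * G TM i)"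

definition radius_squares :: "(nat \<Rightarrow> turing_machine) \<Rightarrow> nat \<Rightarrow> real set" where
  "radius_squares TM k = {c. c > 0 \<and> c \<in> radius_square TM ` {1..k}}"

lemma radius_square_mono: "i \<le> j \<Longrightarrow> radius_square TM i \<le> radius_square TM j"
  unfolding radius_square_def by (intro sum_mono2) (auto simp: G_nonneg)

lemma finite_radius_squares: "finite (radius_squares TM k)"
  by (simp add: radius_squares_def)

lemma radius_squares_mono: "i \<le> k \<Longrightarrow> radius_squares TM i \<subseteq> radius_squares TM k"
  by (auto simp: radius_squares_def)

lemma periodic_orbits_halting_family:
  "periodic_orbits (halting_family TM k) = circle ` radius_squares TM k"
proof -
  have "halting_family TM k = radial_field (\<lambda>s. \<Prod>j=1..k. s - radius_square TM j)"
    by (simp add: halting_family_def radial_field_def radius_square_def)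
  then show ?thesis
    unfolding radius_squares_def by (simp add: periodic_orbits_radial_field[OF _ refl])
qed

lemma card_periodic_orbits:
  "card (periodic_orbits (halting_family TM k)) = card (radius_squares TM k)"
  unfolding periodic_orbits_halting_family
  by (intro card_image inj_on_subset[OF inj_on_circle]) (auto simp: radius_squares_def)

text \<open>
  Passing from \<open>k\<close> to \<open>Suc k\<close> adds one candidate for a squared radius. It exceeds all the previous ones
  if the machine halts. Otherwise it repeats the last one or, for \<open>k = 0\<close>, is 0 and not admitted.
\<close>

lemma card_radius_squares_eq_iff:
  "card (radius_squares TM (Suc k)) = card (radius_squares TM k) \<longleftrightarrow>
    \<not> (\<exists>i. halts_within (TM (Suc k)) (Suc k) i)"
proof -
  let ?r = "radius_square TM"
  have step: "?r (Suc k) = ?r k + real (Suc k) * G TM (Suc k)"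
    by (simp add: radius_square_def)
  show ?thesis
  proof (cases "0 < G TM (Suc k)")
    case True
    then have "?r k < ?r (Suc k)" by (simp add: step)
    then have new: "?r j < ?r (Suc k)" if "j \<le> k" for j
      using radius_square_mono[OF that] by (rule le_less_trans[rotated])
    have "0 < ?r (Suc k)" using new[of 0] by (simp add: radius_square_def)
    then have "radius_squares TM (Suc k) = insert (?r (Suc k)) (radius_squares TM k)"
      by (auto simp: radius_squares_def atLeastAtMostSuc_conv)
    moreover have "?r (Suc k) \<notin> radius_squares TM k"
      using new by (force simp: radius_squares_def)
    ultimately show ?thesis using True by (simp add: finite_radius_squares G_pos_iff)
  next
    case False
    then have "?r (Suc k) = ?r k" using G_nonneg[of TM "Suc k"] by (simp add: step)
    moreover have "?r k \<in> ?r ` {1..k}" if "?r k > 0"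
      using that by (cases "k = 0") (auto simp: radius_square_def)
    ultimately have "radius_squares TM (Suc k) = radius_squares TM k"
      by (auto simp: radius_squares_def atLeastAtMostSuc_conv)
    then show ?thesis using False by (simp add: G_pos_iff)
  qed
qed

text \<open>
  The members of degree at most $2k+2$ are those with index at most \<open>k\<close>, and the number of periodic
  orbits is nondecreasing in the index.
\<close>

lemma sharp_upper_bound_value:
  assumes F: "sharp_upper_bound {1..} (halting_family TM) F" and "k \<ge> 1"
  shows "F (2 * k + 2) = card (radius_squares TM k)"
proof (rule antisym)
  have bound: "card (radius_squares TM i) \<le> F (2 * k + 2)" if "i \<ge> 1" "2 * i + 1 \<le> 2 * k + 2" for i
    using F that unfolding sharp_upper_bound_def
    by (metis atLeast_iff card_periodic_orbits components_degree_le_halting_family le_add2 one_le_numeral order_trans)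
  then show "card (radius_squares TM k) \<le> F (2 * k + 2)" using \<open>k \<ge> 1\<close> by simp
  have "components_degree_le (2 * k + 2) (halting_family TM k)"
    by (simp add: components_degree_le_halting_family)
  moreover have "1 \<le> 2 * k + 2" by simp
  ultimately obtain i where "components_degree_le (2 * k + 2) (halting_family TM i)"
    and i: "card (periodic_orbits (halting_family TM i)) = F (2 * k + 2)"
    using F \<open>k \<ge> 1\<close> unfolding sharp_upper_bound_def by (metis atLeast_iff)
  then have "i \<le> k" by (simp add: components_degree_le_halting_family)
  then show "F (2 * k + 2) \<le> card (radius_squares TM k)"
    unfolding i[symmetric] card_periodic_orbits
    by (intro card_mono finite_radius_squares radius_squares_mono)
qed

theorem theoremC:
  fixes TM :: "nat \<Rightarrow> turing_machine"
  assumes "computable_enumeration TM"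
  shows "polynomial_family {1..} (halting_family TM) \<and>
    \<not> (\<exists>F. computable F \<and> sharp_upper_bound {1..} (halting_family TM) F)"
proof (intro conjI notI)
  show "polynomial_family {1..} (halting_family TM)"
    unfolding polynomial_family_def using components_degree_le_halting_family by blast
next
  assume "\<exists>F. computable F \<and> sharp_upper_bound {1..} (halting_family TM) F"
  then obtain F where "computable F" and F: "sharp_upper_bound {1..} (halting_family TM) F" by blast
  obtain D where "D \<noteq> TM 1"
    and D: "\<And>k. k \<ge> 1 \<Longrightarrow> (\<exists>i. halts_within D k i) \<longleftrightarrow> F (2 * k + 2) = F (2 * k)"
    using machine_detecting_equal_values[OF \<open>computable F\<close>] by blast
  have "D \<in> TM ` {1..}" using assms by (simp add: computable_enumeration_def)
  then obtain k where k: "k \<ge> 1" "D = TM k" by auto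
  with \<open>D \<noteq> TM 1\<close> have "k \<noteq> 1" by blast
  with k obtain m where m: "k = Suc m" "m \<ge> 1" by (cases k) auto
  have "F (2 * k + 2) = card (radius_squares TM (Suc m))" "F (2 * k) = card (radius_squares TM m)"
    using sharp_upper_bound_value[OF F, of k] sharp_upper_bound_value[OF F, of m] k m by simp_all
  then have "(\<exists>i. halts_within (TM k) k i) \<longleftrightarrow> \<not> (\<exists>i. halts_within (TM k) k i)"
    using D[of k] k card_radius_squares_eq_iff[of TM m] m(1) by simp
  then show False by blast
qed

end
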